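(* Let $H$ be a Hilbert space, let $A$ be a linear, closed, densely defined operator in $H$ with null space $N:=N(A)$, and assume that $f=Ay$ with $y\in D(A)$, $y\perp N$. Let $\varepsilon:[0,\infty)\to(0,\infty)$ be a continuous function monotonically decaying to zero as $t\to\infty$ with $\int_0^\infty\varepsilon(s)\,ds=\infty$. For $\varepsilon>0$ let $T_\varepsilon=A^*A+\varepsilon I$ and let $S_\varepsilon$ denote the closure of the operator $T_\varepsilon^{-1}A^*$ with domain $D(A^* )$. Let $u_0\in H$ be arbitrary and consider the problem $$\frac{du}{dt}=-u+S_{\varepsilon(t)}f,\qquad u(0)=u_0 .$$ Then this problem has a unique solution $u(t)$ defined on $[0,\infty)$, the limit $u(\infty):=\lim_{t\to\infty}u(t)$ exists in $H$, and $u(\infty)=y$.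
   Context: $D(\cdot)$ denotes the domain of an operator; "an operator in $H$" means a linear map $D(A)\subset H\to H$, possibly unbounded, not necessarily injective and with range not necessarily closed. $A^*A$ is the nonnegative selfadjoint operator with domain $\{u\in D(A):Au\in D(A^* )\}$, and $I$ is the identity. For each $\varepsilon>0$ the operator $T_\varepsilon^{-1}A^*$, originally defined on $D(A^* )$, is closable and its closure $S_\varepsilon$ is a bounded operator defined on all of $H$. Limits and derivatives are in the norm of $H$. *)

theory Defs
  imports "HOL-Analysis.Analysis"
begin

text \<open>
  Scalars of a Hilbert space. By the Gelfand-Mazur theorem a real normed field is isomorphic
  to the reals or to the complex numbers, and the first axiom determines the conjugation.
\<close>

class hilbert_scalar = real_normed_field +
  fixes conjugate :: "'a \<Rightarrow> 'a"
  assumes conjugate_mult_self: "conjugate a * a = scaleR ((norm a)\<^sup>2) 1"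
    and conjugate_add: "conjugate (a + b) = conjugate a + conjugate b"

instantiation real :: hilbert_scalar
begin
definition conjugate_real :: "real \<Rightarrow> real" where "conjugate_real a = a"
instance by standard (simp_all add: conjugate_real_def power2_eq_square abs_mult_self_eq)
end

instantiation complex :: hilbert_scalar
begin
definition conjugate_complex :: "complex \<Rightarrow> complex" where "conjugate_complex = cnj"
instance
  by standard (simp_all add: conjugate_complex_def complex_eq_iff cmod_def power2_eq_square)
end

text \<open>
  The sort \<open>real_inner\<close> on \<open>'h\<close> is no restriction: the real part of the inner product of a
  complex Hilbert space is a real inner product inducing the same norm, and polarisation of
  \<open>ip_self\<close> forces the class operation \<open>inner\<close> to be the real part of \<open>ip\<close>.
\<close>

locale hilbert_space = vector_space scl
  for scl :: "'k::hilbert_scalar \<Rightarrow> 'h::{real_inner, complete_space} \<Rightarrow> 'h" +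
  fixes ip :: "'h \<Rightarrow> 'h \<Rightarrow> 'k"
  assumes scale_of_real: "scl (of_real r) x = r *\<^sub>R x"
    and ip_add_left: "ip (x + y) z = ip x z + ip y z"
    and ip_scale_left: "ip (scl a x) y = a * ip x y"
    and ip_commute: "ip y x = conjugate (ip x y)"
    and ip_self: "ip x x = of_real (inner x x)"

lemma hilbert_space_real:
  "hilbert_space scaleR (inner :: 'h::{real_inner, complete_space} \<Rightarrow> 'h \<Rightarrow> real)"
proof unfold_locales
  show "y \<bullet> x = conjugate (x \<bullet> y)" for x y :: 'h
    by (simp add: conjugate_real_def inner_commute)
qed (simp_all add: inner_left_distrib scaleR_add_right scaleR_add_left)

lemma hilbert_space_complex: "hilbert_space (*) (\<lambda>x y :: complex. x * cnj y)"
proof unfold_locales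
  show "x * cnj x = of_real (x \<bullet> x)" for x :: complex
    by (simp add: complex_eq_iff inner_complex_def)
qed (simp_all add: distrib_left distrib_right conjugate_complex_def scaleR_conv_of_real mult.commute)

text \<open>
  A possibly unbounded operator \<open>D(A) \<subseteq> H \<rightarrow> H\<close> is represented by its graph. Its domain is
  \<open>Domain A\<close>, its inverse is \<open>A\<inverse>\<close>, its closure (when closable) is the topological closure of
  the graph in the product space, and the product \<open>B A\<close> (first \<open>A\<close>, then \<open>B\<close>), with its natural
  domain \<open>{u \<in> D(A). A u \<in> D(B)}\<close>, is \<open>A O B\<close>.
\<close>

definition linear_operator :: "('k \<Rightarrow> 'h::ab_group_add \<Rightarrow> 'h) \<Rightarrow> ('h \<times> 'h) set \<Rightarrow> bool" where
  "linear_operator scl A \<longleftrightarrow>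
     single_valued A \<and> (0, 0) \<in> A
     \<and> (\<forall>(x, y) \<in> A. \<forall>(x', y') \<in> A. (x + x', y + y') \<in> A)
     \<and> (\<forall>c. \<forall>(x, y) \<in> A. (scl c x, scl c y) \<in> A)"

definition op_apply :: "('h \<times> 'h) set \<Rightarrow> 'h \<Rightarrow> 'h" where
  "op_apply A x = (THE y. (x, y) \<in> A)"

definition null_space :: "('h::zero \<times> 'h) set \<Rightarrow> 'h set" where
  "null_space A = {x. (x, 0) \<in> A}"

definition adjoint_op :: "('h \<Rightarrow> 'h \<Rightarrow> 'k) \<Rightarrow> ('h \<times> 'h) set \<Rightarrow> ('h \<times> 'h) set" where
  "adjoint_op ip A = {(v, w). \<forall>(x, y) \<in> A. ip y v = ip x w}"

definition T_op :: "('h::real_vector \<Rightarrow> 'h \<Rightarrow> 'k) \<Rightarrow> ('h \<times> 'h) set \<Rightarrow> real \<Rightarrow> ('h \<times> 'h) set" where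
  "T_op ip A e = {(x, z + e *\<^sub>R x) | x z. (x, z) \<in> A O adjoint_op ip A}"

definition S_op :: "('h::real_normed_vector \<Rightarrow> 'h \<Rightarrow> 'k) \<Rightarrow> ('h \<times> 'h) set \<Rightarrow> real \<Rightarrow> ('h \<times> 'h) set" where
  "S_op ip A e = closure (adjoint_op ip A O (T_op ip A e)\<inverse>)"

definition cauchy_solution :: "(real \<Rightarrow> 'h \<Rightarrow> 'h) \<Rightarrow> 'h \<Rightarrow> (real \<Rightarrow> 'h::real_normed_vector) \<Rightarrow> bool" where
  "cauchy_solution F u0 u \<longleftrightarrow>
     u 0 = u0 \<and> (\<forall>t\<ge>0. (u has_vector_derivative F t (u t)) (at t within {0..}))"

end

theory Submission imports Defs begin

text \<open>
  Passing to real parts reduces everything to the real inner product. For every \<open>v\<close>, the vector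
  \<open>x = S\<^sub>e v\<close> is the unique solution in \<open>D(A)\<close> of the variational equation
  \<open>\<langle>A x, A z\<rangle> + e \<langle>x, z\<rangle> = \<langle>v, A z\<rangle>\<close> for all \<open>z\<close> in \<open>D(A)\<close>, found by projecting \<open>(0, v)\<close> onto a
  rescaled graph of \<open>A\<close>. For \<open>v = A y\<close> it depends continuously on \<open>e > 0\<close>, and it tends to \<open>y\<close> as
  \<open>e \<rightarrow> 0\<close> because the orthogonal complement of \<open>N(A)\<close> is the closure of the range of \<open>A\<^sup>*\<close>. So the
  equation is \<open>u' = - u + g(t)\<close> with continuous \<open>g(t) \<rightarrow> y\<close>, and the factor \<open>exp t\<close> settles it.
\<close>

section \<open>Orthogonal projection and the Riesz representation\<close>

text \<open>A minimizing sequence for the distance from \<open>x\<close> to \<open>S\<close> is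
  Cauchy by the parallelogram identity; its limit attains the distance, and the first variation
  along \<open>z\<close> in \<open>S\<close> gives orthogonality.\<close>

lemma exists_orthogonal_projection:
  fixes S :: "'a::{real_inner, complete_space} set"
  assumes S: "subspace S"
  shows "\<exists>p\<in>closure S. \<forall>s\<in>S. (x - p) \<bullet> s = 0"
proof -
  have ne: "S \<noteq> {}" using subspace_0[OF S] by auto
  define d where "d = infdist x S"
  have d0: "0 \<le> d" by (simp add: d_def infdist_nonneg)
  have low: "d\<^sup>2 \<le> (norm (x - s))\<^sup>2" if "s \<in> S" for s
    using infdist_le[OF that, of x] d0 by (auto simp: d_def dist_norm intro!: power_mono)
  have "\<exists>s\<in>S. (norm (x - s))\<^sup>2 < d\<^sup>2 + inverse (real (Suc n))" for n
  proof (rule ccontr)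
    assume "\<not> ?thesis"
    then have "sqrt (d\<^sup>2 + inverse (real (Suc n))) \<le> dist x s" if "s \<in> S" for s
      using that by (auto simp: not_less dist_norm intro!: real_le_lsqrt)
    then have "sqrt (d\<^sup>2 + inverse (real (Suc n))) \<le> d"
      using ne by (auto simp: d_def infdist_notempty intro!: cINF_greatest)
    then have "d\<^sup>2 + inverse (real (Suc n)) \<le> d\<^sup>2"
      using sqrt_le_D by blast
    then show False by (simp add: field_simps del: of_nat_Suc)
  qed
  then obtain s where sS: "\<And>n. s n \<in> S"
    and s: "\<And>n. (norm (x - s n))\<^sup>2 < d\<^sup>2 + inverse (real (Suc n))"
    by metis
  have near: "(norm (s m - s n))\<^sup>2 \<le> 2 * inverse (real (Suc m)) + 2 * inverse (real (Suc n))" for m n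
  proof -
    \<comment> \<open>The midpoint lies in \<open>S\<close>, so its distance to \<open>x\<close> is
      at least \<open>d\<close>; the parallelogram identity then leaves only the two excesses over
      \<open>d\<close> squared.\<close>
    have "(1/2) *\<^sub>R (s m + s n) \<in> S"
      using S sS by (intro subspace_scale subspace_add)
    from low[OF this] have "d\<^sup>2 \<le> (norm (x - (1/2) *\<^sub>R (s m + s n)))\<^sup>2" .
    moreover have "(norm (s m - s n))\<^sup>2 = 2 * (norm (x - s m))\<^sup>2 + 2 * (norm (x - s n))\<^sup>2
        - 4 * (norm (x - (1/2) *\<^sub>R (s m + s n)))\<^sup>2"
      unfolding power2_norm_eq_inner by (simp add: algebra_simps inner_commute)
    ultimately show ?thesis using s[of m] s[of n] by linarith
  qed
  have "Cauchy s"
  proof (rule metric_CauchyI)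
    fix e :: real assume e: "0 < e"
    then obtain N where N: "inverse (real (Suc N)) < e\<^sup>2 / 4"
      using reals_Archimedean[of "e\<^sup>2 / 4"] by auto
    have "dist (s m) (s n) < e" if "N \<le> m" "N \<le> n" for m n
    proof -
      have "inverse (real (Suc m)) \<le> inverse (real (Suc N))" "inverse (real (Suc n)) \<le> inverse (real (Suc N))"
        using that by (auto intro!: le_imp_inverse_le)
      then have "(norm (s m - s n))\<^sup>2 < e\<^sup>2" using near[of m n] N by linarith
      then show ?thesis using e by (simp add: dist_norm power2_less_imp_less)
    qed
    then show "\<exists>M. \<forall>m\<ge>M. \<forall>n\<ge>M. dist (s m) (s n) < e" by blast
  qed
  then obtain p where p: "s \<longlonglongrightarrow> p"
    using Cauchy_convergent convergent_def by blast
  have pin: "p \<in> closure S"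
    using sS p closure_sequential by blast
  have "(x - p) \<bullet> z = 0" if z: "z \<in> S" for z
  proof -
    define c where "c = (x - p) \<bullet> z"
    have lim: "(\<lambda>n. d\<^sup>2 + inverse (real (Suc n)) - 2 * t * ((x - s n) \<bullet> z) + t\<^sup>2 * (z \<bullet> z))
        \<longlonglongrightarrow> d\<^sup>2 + 0 - 2 * t * c + t\<^sup>2 * (z \<bullet> z)" for t
      unfolding c_def by (intro tendsto_intros p LIMSEQ_inverse_real_of_nat)
    have ineq: "d\<^sup>2 \<le> d\<^sup>2 + 0 - 2 * t * c + t\<^sup>2 * (z \<bullet> z)" for t
    proof (rule LIMSEQ_le_const[OF lim], intro exI[of _ 0] allI impI)
      fix n
      have "d\<^sup>2 \<le> (norm (x - (s n + t *\<^sub>R z)))\<^sup>2"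
        using S sS z by (intro low subspace_add subspace_scale)
      also have "\<dots> = (norm (x - s n))\<^sup>2 - 2 * t * ((x - s n) \<bullet> z) + t\<^sup>2 * (z \<bullet> z)"
        unfolding power2_norm_eq_inner by (simp add: algebra_simps inner_commute power2_eq_square)
      finally show "d\<^sup>2 \<le> d\<^sup>2 + inverse (real (Suc n)) - 2 * t * ((x - s n) \<bullet> z) + t\<^sup>2 * (z \<bullet> z)"
        using s[of n] by linarith
    qed
    \<comment> \<open>The step \<open>t = c / k\<close> nearly minimizes the quadratic in
      \<open>t\<close>; adding 1 keeps \<open>k\<close> positive even for \<open>z = 0\<close>. The
      inequality becomes \<open>2 c^2 / k \<le> c^2 / k\<close>, so \<open>c = 0\<close>.\<close>
    define k where "k = z \<bullet> z + 1"
    have k: "k > 0" by (simp add: k_def add_nonneg_pos)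
    have "2 * (c / k) * c \<le> (c / k)\<^sup>2 * (z \<bullet> z)"
      using ineq[of "c / k"] by simp
    also have "\<dots> \<le> (c / k)\<^sup>2 * k" by (simp add: k_def mult_left_mono)
    finally have "c\<^sup>2 \<le> 0" using k by (simp add: power2_eq_square field_simps)
    then show ?thesis by (simp add: c_def)
  qed
  with pin show ?thesis by blast
qed

text \<open>The residual \<open>x - p\<close> of the projection is orthogonal to \<open>S\<close>,
  hence to \<open>p\<close> in its closure, and by \<open>orth\<close> to \<open>x\<close>; so it is
  orthogonal to itself. All density claims below go through this criterion.\<close>

lemma in_closure_subspaceI:
  fixes S :: "'a::{real_inner, complete_space} set"
  assumes S: "subspace S"
    and orth: "\<And>q. (\<And>s. s \<in> S \<Longrightarrow> q \<bullet> s = 0) \<Longrightarrow> q \<bullet> x = 0"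
  shows "x \<in> closure S"
proof -
  obtain p where p: "p \<in> closure S" "\<And>s. s \<in> S \<Longrightarrow> (x - p) \<bullet> s = 0"
    using exists_orthogonal_projection[OF S] by blast
  have "closure S \<subseteq> {s. (x - p) \<bullet> s = 0}"
    using p(2) by (intro closure_minimal) (auto intro: closed_hyperplane)
  with p(1) have "(x - p) \<bullet> p = 0" by blast
  moreover have "(x - p) \<bullet> x = 0" using orth p(2) by blast
  ultimately have "(x - p) \<bullet> (x - p) = 0" by (simp add: inner_diff_right)
  then have "x = p" by simp
  with p(1) show ?thesis by simp
qed

text \<open>The representing vector is a multiple of a normal \<open>n\<close> to the kernel:
  subtracting a suitable multiple of \<open>n\<close> moves any \<open>z\<close> into the
  kernel.\<close>

lemma riesz_representation:
  fixes \<phi> :: "'a::{real_inner, complete_space} \<Rightarrow> real"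
  assumes "bounded_linear \<phi>"
  shows "\<exists>g. \<forall>z. \<phi> z = g \<bullet> z"
proof (cases "\<forall>z. \<phi> z = 0")
  case True
  then show ?thesis by (intro exI[of _ 0]) simp
next
  case False
  interpret bounded_linear \<phi> by fact
  define K where "K = {z. \<phi> z = 0}"
  have K: "subspace K" unfolding K_def by (auto simp: subspace_def zero add scaleR)
  have clK: "closed K" unfolding K_def
    by (intro closed_Collect_eq continuous_on continuous_on_id continuous_on_const)
  from False obtain x where x: "\<phi> x \<noteq> 0" by blast
  obtain p where p: "p \<in> K" "\<And>s. s \<in> K \<Longrightarrow> (x - p) \<bullet> s = 0"
    using exists_orthogonal_projection[OF K, of x] clK by (metis closure_closed)
  define n where "n = x - p"
  have n: "\<phi> n \<noteq> 0" using x p(1) by (simp add: n_def K_def diff)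
  then have nn: "n \<bullet> n \<noteq> 0" by (auto simp: zero)
  have "\<phi> z = ((\<phi> n / (n \<bullet> n)) *\<^sub>R n) \<bullet> z" for z
  proof -
    have "z - (\<phi> z / \<phi> n) *\<^sub>R n \<in> K" using n by (simp add: K_def diff scaleR)
    then have "n \<bullet> (z - (\<phi> z / \<phi> n) *\<^sub>R n) = 0" using p(2) by (simp add: n_def)
    then show ?thesis using n nn by (simp add: inner_diff_right field_simps)
  qed
  then show ?thesis by blast
qed

section \<open>Linear differential equations on a half-line\<close>

lemma vector_derivative_bound:
  fixes f :: "real \<Rightarrow> 'a::real_normed_vector"
  assumes "convex S" "a \<in> S" "b \<in> S"
    and "\<And>t. t \<in> S \<Longrightarrow> (f has_vector_derivative f' t) (at t within S)"
    and "\<And>t. t \<in> S \<Longrightarrow> norm (f' t) \<le> B"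
  shows "norm (f b - f a) \<le> B * \<bar>b - a\<bar>"
proof -
  have "norm (f b - f a) \<le> B * norm (b - a)"
  proof (rule differentiable_bound[OF assms(1)])
    show "(f has_derivative (\<lambda>h. h *\<^sub>R f' t)) (at t within S)" if "t \<in> S" for t
      using assms(4)[OF that] by (simp add: has_vector_derivative_def)
    show "onorm (\<lambda>h. h *\<^sub>R f' t) \<le> B" if "t \<in> S" for t
      using mult_right_mono[OF assms(5)[OF that], of "\<bar>h\<bar>" for h]
      by (intro onorm_le) (simp add: mult.commute)
  qed (use assms in auto)
  then show ?thesis by simp
qed

text \<open>
  The sort of \<open>'a\<close> does not entail \<open>banach\<close>, which the library's vector-valued integral
  needs; the integral is therefore taken weakly and represented by Riesz.
\<close>

lemma exists_antiderivative:
  fixes g :: "real \<Rightarrow> 'a::{real_inner, complete_space}"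
  assumes g: "continuous_on {0..} g"
  shows "\<exists>G. G 0 = 0 \<and> (\<forall>t\<ge>0. (G has_vector_derivative g t) (at t within {0..}))"
proof -
  have cont: "continuous_on {a..b} (\<lambda>s. g s \<bullet> z)" if "0 \<le> a" for a b z
    using that by (intro continuous_intros continuous_on_subset[OF g]) auto
  have int: "(\<lambda>s. g s \<bullet> z) integrable_on {0..t}" for t z
    by (intro integrable_continuous_real cont) simp
  have "\<exists>w. \<forall>z. integral {0..t} (\<lambda>s. g s \<bullet> z) = w \<bullet> z" for t
  proof (rule riesz_representation)
    have "bounded (g ` {0..t})"
      by (intro compact_imp_bounded compact_continuous_image continuous_on_subset[OF g]) auto
    then obtain C where C0: "0 < C" and C: "\<And>s. s \<in> {0..t} \<Longrightarrow> norm (g s) \<le> C"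
      unfolding bounded_pos by blast
    show "bounded_linear (\<lambda>z. integral {0..t} (\<lambda>s. g s \<bullet> z))"
    proof (rule bounded_linear_intro[where K = "C * \<bar>t\<bar>"])
      fix z
      show "norm (integral {0..t} (\<lambda>s. g s \<bullet> z)) \<le> norm z * (C * \<bar>t\<bar>)"
      proof (cases "0 \<le> t")
        case True
        have "norm (integral {0..t} (\<lambda>s. g s \<bullet> z)) \<le> (C * norm z) * (t - 0)"
        proof (rule integral_bound[OF True cont])
          fix s assume s: "s \<in> {0..t}"
          have "norm (g s \<bullet> z) \<le> norm (g s) * norm z" by (simp add: Cauchy_Schwarz_ineq2)
          also have "\<dots> \<le> C * norm z" using C[OF s] by (simp add: mult_right_mono)
          finally show "norm (g s \<bullet> z) \<le> C * norm z" .
        qed simp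
        then show ?thesis using True by (simp add: mult_ac)
      next
        \<comment> \<open>For negative \<open>t\<close> the interval is empty and the integral is 0;
          \<open>G\<close> is chosen for every real \<open>t\<close>.\<close>
        case False
        moreover have "0 \<le> norm z * (C * \<bar>t\<bar>)" using C0 by simp
        ultimately show ?thesis by simp
      qed
    qed (simp_all add: inner_add_right int integral_add)
  qed
  then obtain G where G: "\<And>t z. integral {0..t} (\<lambda>s. g s \<bullet> z) = G t \<bullet> z"
    by metis
  have "(G has_vector_derivative g t) (at t within {0..})" if t: "0 \<le> t" for t
    unfolding has_vector_derivative_def has_derivative_within_alt
  proof (intro conjI allI impI bounded_linear_scaleR_left)
    fix e :: real assume e: "0 < e"
    from g t e have "\<exists>r>0. \<forall>s\<in>{0..}. dist s t < r \<longrightarrow> dist (g s) (g t) < e"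
      unfolding continuous_on_iff by simp
    then obtain r where r: "0 < r" "\<And>s. 0 \<le> s \<Longrightarrow> dist s t < r \<Longrightarrow> dist (g s) (g t) < e"
      by auto
    have "norm (G s - G t - (s - t) *\<^sub>R g t) \<le> e * norm (s - t)" if s: "0 \<le> s" "norm (s - t) < r" for s
    proof -
      \<comment> \<open>The remainder itself is the test vector: the weak estimate is uniform in the
        test vector, so it yields
        \<open>norm w * norm w \<le> e * \<bar>s - t\<bar> * norm w\<close>, and one factor
        cancels.\<close>
      define w where "w = G s - G t - (s - t) *\<^sub>R g t"
      \<comment> \<open>The segment between \<open>s\<close> and \<open>t\<close> in either order,
        so that both one-sided difference quotients are treated at once.\<close>
      define S where "S = {min s t..max s t}"
      have S: "S \<subseteq> {0..max s t}" "\<And>q. q \<in> S \<Longrightarrow> 0 \<le> q \<and> dist q t < r"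
        using s t by (auto simp: S_def dist_real_def)
      have "norm ((G s \<bullet> w - s *\<^sub>R (g t \<bullet> w)) - (G t \<bullet> w - t *\<^sub>R (g t \<bullet> w)))
          \<le> (e * norm w) * \<bar>s - t\<bar>"
      proof (rule vector_derivative_bound[where S = S])
        fix q assume q: "q \<in> S"
        have "((\<lambda>q. G q \<bullet> w) has_vector_derivative g q \<bullet> w) (at q within {0..max s t})"
          unfolding G[symmetric]
          using q S by (intro integral_has_vector_derivative cont) auto
        from has_vector_derivative_within_subset[OF this S(1)]
        show "((\<lambda>q. G q \<bullet> w - q *\<^sub>R (g t \<bullet> w)) has_vector_derivative
            g q \<bullet> w - 1 *\<^sub>R (g t \<bullet> w)) (at q within S)"
          by (auto intro!: derivative_eq_intros)
        have "norm (g q \<bullet> w - 1 *\<^sub>R (g t \<bullet> w)) = norm ((g q - g t) \<bullet> w)"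
          by (simp add: inner_diff_left)
        also have "\<dots> \<le> norm (g q - g t) * norm w" by (simp add: Cauchy_Schwarz_ineq2)
        also have "\<dots> \<le> e * norm w"
          using r(2)[of q] S(2)[OF q] by (auto simp: dist_norm intro!: mult_right_mono)
        finally show "norm (g q \<bullet> w - 1 *\<^sub>R (g t \<bullet> w)) \<le> e * norm w" .
      qed (auto simp: S_def)
      also have "(G s \<bullet> w - s *\<^sub>R (g t \<bullet> w)) - (G t \<bullet> w - t *\<^sub>R (g t \<bullet> w)) = w \<bullet> w"
        by (simp add: w_def algebra_simps)
      finally have "norm w * norm w \<le> (e * \<bar>s - t\<bar>) * norm w"
        by (simp add: mult_ac power2_eq_square flip: power2_norm_eq_inner)
      then show ?thesis
        using e by (cases "norm w = 0") (auto simp: w_def[symmetric] mult_le_cancel_right)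
    qed
    then show "\<exists>d>0. \<forall>s\<in>{0..}. norm (s - t) < d \<longrightarrow>
        norm (G s - G t - (s - t) *\<^sub>R g t) \<le> e * norm (s - t)"
      using r(1) by auto
  qed
  moreover have "G 0 = 0" using G[of 0 "G 0"] by simp
  ultimately show ?thesis by blast
qed

section \<open>The relaxation equation \<open>u' = - u + g\<close>: integrating factor, existence,
  uniqueness, limit\<close>

lemma cauchy_solution_relaxation_exp:
  assumes "cauchy_solution (\<lambda>t x. - x + g t) u0 u" and "0 \<le> t"
  shows "((\<lambda>t. exp t *\<^sub>R (u t - y)) has_vector_derivative exp t *\<^sub>R (g t - y)) (at t within {0..})"
proof -
  have "(u has_vector_derivative (- u t + g t)) (at t within {0..})"
    using assms by (simp add: cauchy_solution_def)
  \<comment> \<open>In the product rule the two terms with \<open>u t\<close> cancel. The free shift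
    \<open>y\<close> is 0 for uniqueness and the limit of \<open>g\<close> for convergence.\<close>
  then have "((\<lambda>t. exp t *\<^sub>R (u t - y)) has_vector_derivative
      exp t *\<^sub>R (- u t + g t - 0) + exp t *\<^sub>R (u t - y)) (at t within {0..})"
    by (intro has_vector_derivative_scaleR has_vector_derivative_diff has_vector_derivative_const)
       (auto intro!: derivative_eq_intros)
  then show ?thesis by (simp add: algebra_simps)
qed

text \<open>Variation of constants: with \<open>G\<close> an antiderivative of
  \<open>exp t *\<^sub>R g t\<close>, the solution is
  \<open>exp (- t) *\<^sub>R (u0 + G t)\<close>.\<close>

lemma relaxation_solution_exists:
  fixes g :: "real \<Rightarrow> 'a::{real_inner, complete_space}"
  assumes g: "continuous_on {0..} g"
  shows "\<exists>u. cauchy_solution (\<lambda>t x. - x + g t) u0 u"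
proof -
  have "continuous_on {0..} (\<lambda>t. exp t *\<^sub>R g t)"
    by (intro continuous_intros g)
  from exists_antiderivative[OF this] obtain G where G: "G 0 = 0"
    "\<And>t. 0 \<le> t \<Longrightarrow> (G has_vector_derivative exp t *\<^sub>R g t) (at t within {0..})" by blast
  have "((\<lambda>t. exp (- t) *\<^sub>R (u0 + G t)) has_vector_derivative
      - (exp (- t) *\<^sub>R (u0 + G t)) + g t) (at t within {0..})" if t: "0 \<le> t" for t
  proof -
    have "((\<lambda>t. exp (- t) *\<^sub>R (u0 + G t)) has_vector_derivative
        exp (- t) *\<^sub>R (0 + exp t *\<^sub>R g t) + (- exp (- t)) *\<^sub>R (u0 + G t)) (at t within {0..})"
      by (intro has_vector_derivative_scaleR has_vector_derivative_add has_vector_derivative_const G t)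
         (auto intro!: derivative_eq_intros)
    then show ?thesis by (simp add: algebra_simps flip: exp_add)
  qed
  then show ?thesis
    unfolding cauchy_solution_def using G(1)
    by (intro exI[of _ "\<lambda>t. exp (- t) *\<^sub>R (u0 + G t)"]) auto
qed

text \<open>After multiplication by \<open>exp t\<close> both solutions have the same derivative, so
  their difference stays at its initial value 0.\<close>

lemma relaxation_solution_unique:
  fixes g :: "real \<Rightarrow> 'a::real_normed_vector"
  assumes u: "cauchy_solution (\<lambda>t x. - x + g t) u0 u"
    and v: "cauchy_solution (\<lambda>t x. - x + g t) u0 v" and t: "0 \<le> t"
  shows "v t = u t"
proof -
  have "norm ((exp t *\<^sub>R (v t - 0) - exp t *\<^sub>R (u t - 0)) - (exp 0 *\<^sub>R (v 0 - 0) - exp 0 *\<^sub>R (u 0 - 0)))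
      \<le> 0 * \<bar>t - 0\<bar>"
  proof (rule vector_derivative_bound[where S = "{0..}"])
    show "((\<lambda>t. exp t *\<^sub>R (v t - 0) - exp t *\<^sub>R (u t - 0)) has_vector_derivative
        exp s *\<^sub>R (g s - 0) - exp s *\<^sub>R (g s - 0)) (at s within {0..})" if "s \<in> {0..}" for s
      using that by (intro has_vector_derivative_diff cauchy_solution_relaxation_exp[OF u]
          cauchy_solution_relaxation_exp[OF v]) auto
  qed (use t in auto)
  moreover have "v 0 = u 0" using u v by (simp add: cauchy_solution_def)
  ultimately show ?thesis by simp
qed

text \<open>Once \<open>g\<close> is within \<open>e / 2\<close> of \<open>y\<close>, the derivative
  of \<open>exp t *\<^sub>R (u t - y)\<close> is dominated by that of \<open>e / 2 * exp t\<close>.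
  Integrating from \<open>T\<close> and dividing by \<open>exp t\<close> leaves \<open>e / 2\<close>
  plus an exponentially decaying term.\<close>

lemma relaxation_solution_tendsto:
  fixes g :: "real \<Rightarrow> 'a::real_normed_vector"
  assumes u: "cauchy_solution (\<lambda>t x. - x + g t) u0 u" and g: "(g \<longlongrightarrow> y) at_top"
  shows "(u \<longlongrightarrow> y) at_top"
proof (rule tendstoI)
  fix e :: real assume e: "0 < e"
  then have "eventually (\<lambda>t. dist (g t) y < e / 2 \<and> 0 \<le> t) at_top"
    using g by (intro eventually_conj tendstoD eventually_ge_at_top) auto
  then obtain T where T: "\<And>t. T \<le> t \<Longrightarrow> dist (g t) y < e / 2 \<and> 0 \<le> t"
    by (auto simp: eventually_at_top_linorder)
  define C where "C = exp T * norm (u T - y)"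
  have bound: "norm (u t - y) \<le> C * exp (- t) + e / 2" if t: "T \<le> t" for t
  proof -
    have "norm (exp t *\<^sub>R (u t - y) - exp T *\<^sub>R (u T - y)) \<le> e / 2 * exp t - e / 2 * exp T"
    proof (cases "T = t")
      case False
      have der: "((\<lambda>t. exp t *\<^sub>R (u t - y)) has_vector_derivative exp s *\<^sub>R (g s - y)) (at s within {0..})"
        if "T \<le> s" for s using cauchy_solution_relaxation_exp[OF u] T[OF that] by blast
      show ?thesis
      proof (rule differentiable_bound_general[where f' = "\<lambda>s. exp s *\<^sub>R (g s - y)"
            and \<phi>' = "\<lambda>s. e / 2 * exp s"])
        show "T < t" using False t by simp
        show "continuous_on {T..t} (\<lambda>t. exp t *\<^sub>R (u t - y))"
          unfolding continuous_on_eq_continuous_within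
          using T by (auto intro!: has_vector_derivative_continuous
              has_vector_derivative_within_subset[OF der])
        show "((\<lambda>t. exp t *\<^sub>R (u t - y)) has_vector_derivative exp s *\<^sub>R (g s - y)) (at s)"
          if "T < s" "s < t" for s
          \<comment> \<open>Since \<open>s > T \<ge> 0\<close> is interior to the half-line, the
            one-sided notion of derivative is the full one here.\<close>
          using der[of s] that T[of T] at_within_interior[of s "{0..}"] by auto
        show "norm (exp s *\<^sub>R (g s - y)) \<le> e / 2 * exp s" if "T < s" "s < t" for s
          using T[of s] that by (simp add: dist_norm)
      qed (auto intro!: derivative_eq_intros continuous_intros
            simp flip: has_real_derivative_iff_has_vector_derivative)
    qed simp
    moreover have "norm (exp t *\<^sub>R (u t - y)) \<le>
        norm (exp T *\<^sub>R (u T - y)) + norm (exp t *\<^sub>R (u t - y) - exp T *\<^sub>R (u T - y))"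
      using norm_triangle_ineq[of "exp T *\<^sub>R (u T - y)" "exp t *\<^sub>R (u t - y) - exp T *\<^sub>R (u T - y)"]
      by simp
    moreover have "0 \<le> e / 2 * exp T" using e by simp
    ultimately have "exp t * norm (u t - y) \<le> C + e / 2 * exp t" by (simp add: C_def)
    then show ?thesis by (simp add: exp_minus field_simps)
  qed
  have "((\<lambda>t::real. C * exp (- t)) \<longlongrightarrow> C * 0) at_top"
    by (intro tendsto_intros filterlim_compose[OF exp_at_bot] filterlim_uminus_at_bot_at_top)
  then have "eventually (\<lambda>t. dist (C * exp (- t)) (C * 0) < e / 2) at_top"
    using e by (intro tendstoD) auto
  with eventually_ge_at_top[of T] show "eventually (\<lambda>t. dist (u t) y < e) at_top"
  proof eventually_elim
    case (elim t)
    then show ?case using bound[of t] by (simp add: dist_norm)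
  qed
qed

section \<open>The regularized operator\<close>

text \<open>The pairs \<open>(v, x)\<close> satisfy the Euler-Lagrange equation of the Tikhonov
  functional \<open>norm (A x - v)^2 + e * norm x^2\<close>. Being weak, it makes sense also for
  \<open>v\<close> outside the domain of the adjoint, where the closure \<open>S_op\<close> must be
  described.\<close>

definition tikhonov :: "('h::real_inner \<times> 'h) set \<Rightarrow> real \<Rightarrow> ('h \<times> 'h) set" where
  "tikhonov A e = {(v, x). \<exists>a. (x, a) \<in> A \<and> (\<forall>(z, b) \<in> A. a \<bullet> b + e * (x \<bullet> z) = v \<bullet> b)}"

lemma tikhonovE:
  assumes "(v, x) \<in> tikhonov A e"
  obtains a where "(x, a) \<in> A" "\<And>z b. (z, b) \<in> A \<Longrightarrow> a \<bullet> b + e * (x \<bullet> z) = v \<bullet> b"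
proof -
  from assms obtain a where "(x, a) \<in> A" "\<forall>(z, b) \<in> A. a \<bullet> b + e * (x \<bullet> z) = v \<bullet> b"
    unfolding tikhonov_def by blast
  then show thesis by (intro that[of a]) auto
qed

lemma adjoint_op_inner_iff:
  "(v, w) \<in> adjoint_op inner A \<longleftrightarrow> (\<forall>(x, y)\<in>A. y \<bullet> v = x \<bullet> w)"
  by (simp add: adjoint_op_def)

text \<open>If \<open>w\<close> is the adjoint applied to \<open>v\<close>, then
  \<open>v \<bullet> b = w \<bullet> z\<close> on the graph. The weak equation then says exactly
  that \<open>a\<close> is in the domain of the adjoint with value \<open>w - e *\<^sub>R x\<close>,
  which is the equation \<open>T x = w\<close>.\<close>

lemma adjoint_comp_T_inverse_eq:
  "adjoint_op inner A O (T_op inner A e)\<inverse> = tikhonov A e \<inter> (Domain (adjoint_op inner A) \<times> UNIV)"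
proof (intro equalityI subrelI)
  fix v x assume "(v, x) \<in> adjoint_op inner A O (T_op inner A e)\<inverse>"
  then obtain w a z where "(v, w) \<in> adjoint_op inner A" "w = z + e *\<^sub>R x" "(x, a) \<in> A"
    "(a, z) \<in> adjoint_op inner A"
    by (auto simp: T_op_def)
  then show "(v, x) \<in> tikhonov A e \<inter> (Domain (adjoint_op inner A) \<times> UNIV)"
    unfolding tikhonov_def
    by (fastforce simp: adjoint_op_inner_iff inner_add_right inner_commute)
next
  fix v x assume vx: "(v, x) \<in> tikhonov A e \<inter> (Domain (adjoint_op inner A) \<times> UNIV)"
  then obtain w where w: "(v, w) \<in> adjoint_op inner A" by blast
  from vx have "(v, x) \<in> tikhonov A e" by blast
  then obtain a where a: "(x, a) \<in> A" "\<And>z b. (z, b) \<in> A \<Longrightarrow> a \<bullet> b + e * (x \<bullet> z) = v \<bullet> b"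
    by (elim tikhonovE) blast
  have "(a, w - e *\<^sub>R x) \<in> adjoint_op inner A"
    using w a(2) by (fastforce simp: adjoint_op_inner_iff inner_diff_right inner_commute)
  with a(1) have "(x, w) \<in> T_op inner A e"
    unfolding T_op_def by (intro CollectI exI[of _ x] exI[of _ "w - e *\<^sub>R x"]) auto
  with w show "(v, x) \<in> adjoint_op inner A O (T_op inner A e)\<inverse>" by blast
qed

lemma subspace_adjoint_op: "subspace (adjoint_op inner A)"
  by (fastforce simp: subspace_def adjoint_op_inner_iff zero_prod_def inner_add_right)

text \<open>Testing with \<open>z = x\<close> and absorbing \<open>v \<bullet> a\<close> by Young's
  inequality. Applied to differences, it gives uniqueness and continuous dependence on
  \<open>v\<close>.\<close>

lemma tikhonov_bound:
  assumes "(v, x) \<in> tikhonov A e"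
  shows "e * (norm x)\<^sup>2 \<le> (norm v)\<^sup>2"
proof -
  from assms obtain a where "a \<bullet> a + e * (x \<bullet> x) = v \<bullet> a"
    by (auto simp: tikhonov_def)
  moreover have "2 * (v \<bullet> a) \<le> v \<bullet> v + a \<bullet> a"
    using inner_ge_zero[of "v - a"] by (simp add: inner_diff_left inner_diff_right inner_commute)
  moreover have "0 \<le> v \<bullet> v" "0 \<le> a \<bullet> a" by simp_all
  ultimately have "e * (x \<bullet> x) \<le> v \<bullet> v" by argo
  then show ?thesis by (simp add: power2_norm_eq_inner)
qed

section \<open>Closed graphs: duality with the adjoint, and solvability of the variational
  equation\<close>

locale closed_graph_operator =
  fixes A :: "('h::{real_inner, complete_space} \<times> 'h) set"
  assumes subspace: "subspace A" and closed: "closed A" and single_valued: "single_valued A"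
begin

text \<open>This is the inclusion of the double adjoint in \<open>A\<close>: a vector
  \<open>r\<close> orthogonal to the graph corresponds to the element
  \<open>(snd r, - fst r)\<close> of the adjoint, so the assumption makes \<open>(p, q)\<close>
  orthogonal to \<open>r\<close>.\<close>

lemma biorthogonal_graph:
  assumes "\<And>v w. (v, w) \<in> adjoint_op inner A \<Longrightarrow> p \<bullet> w = q \<bullet> v"
  shows "(p, q) \<in> A"
proof -
  have "(p, q) \<in> closure A"
  proof (rule in_closure_subspaceI[OF subspace])
    fix r assume r: "\<And>s. s \<in> A \<Longrightarrow> r \<bullet> s = 0"
    have "fst r \<bullet> x + snd r \<bullet> y = 0" if "(x, y) \<in> A" for x y
      using r[OF that] by (simp add: inner_prod_def)
    then have "(snd r, - fst r) \<in> adjoint_op inner A"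
      by (fastforce simp: adjoint_op_inner_iff inner_commute add_eq_0_iff)
    from assms[OF this] show "r \<bullet> (p, q) = 0"
      by (simp add: inner_prod_def inner_commute)
  qed
  then show ?thesis using closed by simp
qed

text \<open>If \<open>q\<close> is orthogonal to the domain of the adjoint, then
  \<open>(0, q)\<close> lies in the double adjoint, hence in \<open>A\<close>, and single-valuedness
  forces \<open>q = 0\<close>.\<close>

lemma adjoint_densely_defined: "closure (Domain (adjoint_op inner A)) = UNIV"
proof -
  have "subspace (fst ` adjoint_op inner A)"
    by (intro linear_subspace_image linear_fst subspace_adjoint_op)
  then have sub: "subspace (Domain (adjoint_op inner A))" by (simp add: Domain_fst)
  have "x \<in> closure (Domain (adjoint_op inner A))" for x
  proof (rule in_closure_subspaceI[OF sub])
    fix q assume q: "\<And>s. s \<in> Domain (adjoint_op inner A) \<Longrightarrow> q \<bullet> s = 0"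
    have "(0, q) \<in> A" using q by (intro biorthogonal_graph) auto
    moreover have "(0, 0) \<in> A" using subspace_0[OF subspace] by (simp add: zero_prod_def)
    ultimately have "q = 0" using single_valued by (auto dest: single_valuedD)
    then show "q \<bullet> x = 0" by simp
  qed
  then show ?thesis by blast
qed

text \<open>A vector \<open>q\<close> orthogonal to the range of the adjoint satisfies
  \<open>(q, 0) \<in> A\<close> by biorthogonality, so it is a null vector and \<open>y\<close> is
  orthogonal to it.\<close>

lemma in_closure_Range_adjoint:
  assumes "\<And>q. q \<in> null_space A \<Longrightarrow> y \<bullet> q = 0"
  shows "y \<in> closure (Range (adjoint_op inner A))"
proof -
  have "subspace (snd ` adjoint_op inner A)"
    by (intro linear_subspace_image linear_snd subspace_adjoint_op)
  then have sub: "subspace (Range (adjoint_op inner A))" by (simp add: Range_snd)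
  show ?thesis
  proof (rule in_closure_subspaceI[OF sub])
    fix q assume q: "\<And>s. s \<in> Range (adjoint_op inner A) \<Longrightarrow> q \<bullet> s = 0"
    have "(q, 0) \<in> A" using q by (intro biorthogonal_graph) auto
    then show "q \<bullet> y = 0" using assms by (simp add: null_space_def inner_commute)
  qed
qed

lemma tikhonov_diff:
  assumes "(v, x) \<in> tikhonov A e" "(v', x') \<in> tikhonov A e"
  shows "(v - v', x - x') \<in> tikhonov A e"
proof -
  from assms obtain a a' where a: "(x, a) \<in> A" "\<And>z b. (z, b) \<in> A \<Longrightarrow> a \<bullet> b + e * (x \<bullet> z) = v \<bullet> b"
    and a': "(x', a') \<in> A" "\<And>z b. (z, b) \<in> A \<Longrightarrow> a' \<bullet> b + e * (x' \<bullet> z) = v' \<bullet> b"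
    by (elim tikhonovE) blast
  have "(x - x', a - a') \<in> A" using subspace_diff[OF subspace a(1) a'(1)] by simp
  moreover have "(a - a') \<bullet> b + e * ((x - x') \<bullet> z) = (v - v') \<bullet> b" if "(z, b) \<in> A" for z b
    using a(2)[OF that] a'(2)[OF that] by (simp add: inner_diff_left algebra_simps)
  ultimately show ?thesis by (auto simp: tikhonov_def)
qed

lemma tikhonov_total:
  assumes e: "0 < e"
  shows "\<exists>x. (v, x) \<in> tikhonov A e"
proof -
  define L where "L = (\<lambda>r :: 'h \<times> 'h. ((1 / sqrt e) *\<^sub>R fst r, snd r))"
  have L: "linear L" by (rule linearI) (auto simp: L_def algebra_simps)
  have "continuous_on UNIV L" unfolding L_def by (intro continuous_intros)
  then have cl: "closed (L -` A)" using closed by (simp add: closed_vimage)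
  have sub: "subspace (L -` A)" using L subspace by (rule linear_subspace_vimage)
  obtain p where p: "p \<in> L -` A" "\<And>s. s \<in> L -` A \<Longrightarrow> ((0, v) - p) \<bullet> s = 0"
    using exists_orthogonal_projection[OF sub, of "(0, v)"] cl by (metis closure_closed)
  define x a where "x = (1 / sqrt e) *\<^sub>R fst p" and "a = snd p"
  have "(x, a) \<in> A" using p(1) by (simp add: x_def a_def L_def)
  moreover have "a \<bullet> b + e * (x \<bullet> z) = v \<bullet> b" if "(z, b) \<in> A" for z b
  proof -
    have "(sqrt e *\<^sub>R z, b) \<in> L -` A" using that e by (simp add: L_def)
    from p(2)[OF this] have "v \<bullet> b = sqrt e * (fst p \<bullet> z) + a \<bullet> b"
      by (simp add: inner_prod_def a_def inner_diff_left)
    moreover have "e * (x \<bullet> z) = (e / sqrt e) * (fst p \<bullet> z)"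
      by (simp add: x_def)
    moreover have "e / sqrt e = sqrt e" using e by (simp add: real_div_sqrt)
    ultimately show ?thesis by simp
  qed
  ultimately show ?thesis by (auto simp: tikhonov_def)
qed

text \<open>The weak solution relation is closed, and by density of the domain of the adjoint and
  continuous dependence on the datum, its restriction to that domain is dense in it.\<close>

lemma S_op_eq_tikhonov:
  assumes e: "0 < e"
  shows "S_op inner A e = tikhonov A e"
proof -
  let ?D = "Domain (adjoint_op inner A)"
  have "(v, x) \<in> tikhonov A e" if vx: "(v, x) \<in> closure (tikhonov A e \<inter> (?D \<times> UNIV))" for v x
  proof -
    obtain r where r: "\<And>n. r n \<in> tikhonov A e" "r \<longlonglongrightarrow> (v, x)"
      using vx unfolding closure_sequential by blast
    \<comment> \<open>The sequence is compared with the genuine solution \<open>x'\<close> for the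
      limit datum; the bound passes to the limit and identifies \<open>x\<close> with
      \<open>x'\<close>.\<close>
    obtain x' where x': "(v, x') \<in> tikhonov A e" using tikhonov_total[OF e] by blast
    have le: "e * (norm (snd (r n) - x'))\<^sup>2 \<le> (norm (fst (r n) - v))\<^sup>2" for n
      using tikhonov_bound[OF tikhonov_diff[OF _ x', of "fst (r n)" "snd (r n)"]] r(1)[of n] by simp
    have "(\<lambda>n. e * (norm (snd (r n) - x'))\<^sup>2) \<longlonglongrightarrow> e * (norm (snd (v, x) - x'))\<^sup>2"
      and "(\<lambda>n. (norm (fst (r n) - v))\<^sup>2) \<longlonglongrightarrow> (norm (fst (v, x) - v))\<^sup>2"
      by (intro tendsto_intros r(2))+
    then have "e * (norm (snd (v, x) - x'))\<^sup>2 \<le> (norm (fst (v, x) - v))\<^sup>2"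
      by (rule LIMSEQ_le) (use le in blast)
    then have "x = x'" using e by (simp add: mult_le_0_iff)
    with x' show ?thesis by simp
  qed
  moreover have "(v, x) \<in> closure (tikhonov A e \<inter> (?D \<times> UNIV))" if vx: "(v, x) \<in> tikhonov A e" for v x
  proof -
    have "v \<in> closure ?D" by (simp add: adjoint_densely_defined)
    then obtain w where w: "\<And>n. w n \<in> ?D" "w \<longlonglongrightarrow> v"
      unfolding closure_sequential by blast
    have "\<forall>n. \<exists>z. (w n, z) \<in> tikhonov A e" using tikhonov_total[OF e] by blast
    then obtain X where X: "\<And>n. (w n, X n) \<in> tikhonov A e" by metis
    have "(\<lambda>n. (norm (X n - x))\<^sup>2) \<longlonglongrightarrow> 0"
    proof (rule tendsto_sandwich[where f = "\<lambda>_. 0" and h = "\<lambda>n. (norm (w n - v))\<^sup>2 / e"])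
      have "(\<lambda>n. (norm (w n - v))\<^sup>2 / e) \<longlonglongrightarrow> (norm (v - v))\<^sup>2 / e"
        using e by (intro tendsto_intros w(2)) simp
      then show "(\<lambda>n. (norm (w n - v))\<^sup>2 / e) \<longlonglongrightarrow> 0" by simp
      have "(norm (X n - x))\<^sup>2 \<le> (norm (w n - v))\<^sup>2 / e" for n
        using tikhonov_bound[OF tikhonov_diff[OF X[of n] vx]] e by (simp add: field_simps)
      then show "\<forall>\<^sub>F n in sequentially. (norm (X n - x))\<^sup>2 \<le> (norm (w n - v))\<^sup>2 / e" by simp
    qed simp_all
    from tendsto_real_sqrt[OF this] have "X \<longlonglongrightarrow> x"
      by (simp add: tendsto_norm_zero_iff LIM_zero_iff)
    then have "(\<lambda>n. (w n, X n)) \<longlonglongrightarrow> (v, x)" using w(2) by (rule tendsto_Pair[rotated])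
    moreover have "(w n, X n) \<in> tikhonov A e \<inter> (?D \<times> UNIV)" for n using w X by blast
    ultimately show ?thesis
      unfolding closure_sequential by (intro exI[of _ "\<lambda>n. (w n, X n)"]) blast
  qed
  ultimately show ?thesis
    unfolding S_op_def adjoint_comp_T_inverse_eq by auto
qed

text \<open>The description in \<open>op_apply\<close> is proper here: a solution exists for every
  \<open>v\<close>, and the bound for the datum \<open>v - v\<close> makes it unique.\<close>

lemma op_apply_S_op:
  assumes e: "0 < e"
  shows "(v, op_apply (S_op inner A e) v) \<in> tikhonov A e"
proof -
  obtain x where x: "(v, x) \<in> tikhonov A e" using tikhonov_total[OF e] by blast
  moreover have "x' = x" if "(v, x') \<in> tikhonov A e" for x'
    using tikhonov_bound[OF tikhonov_diff[OF that x]] e by (simp add: mult_le_0_iff)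
  ultimately show ?thesis
    unfolding op_apply_def S_op_eq_tikhonov[OF e] by (rule theI)
qed

section \<open>Exact data \<open>f = A y\<close>: dependence of the regularized solution on the
  parameter \<open>e\<close>\<close>

lemma tikhonov_exact_data:
  assumes y: "(y, f) \<in> A" and x: "(f, x) \<in> tikhonov A e" and e: "0 < e"
  shows "norm x \<le> norm y" and "(norm (x - y))\<^sup>2 \<le> (y - x) \<bullet> y"
    and "\<exists>a. (x, a) \<in> A \<and> (norm (a - f))\<^sup>2 \<le> e * (norm y)\<^sup>2"
proof -
  from x obtain a where a: "(x, a) \<in> A" "\<And>z b. (z, b) \<in> A \<Longrightarrow> a \<bullet> b + e * (x \<bullet> z) = f \<bullet> b"
    by (elim tikhonovE) blast
  \<comment> \<open>Testing with \<open>x - y\<close>, whose image is \<open>a - f\<close>, turns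
    the equation into \<open>norm (a - f)^2 = e * (x \<bullet> (y - x))\<close>. Its sign gives
    \<open>x \<bullet> x \<le> x \<bullet> y\<close>, the source of the first two bounds; its size
    gives the third.\<close>
  have "(x - y, a - f) \<in> A" using subspace_diff[OF subspace a(1) y] by simp
  from a(2)[OF this] have eq: "(norm (a - f))\<^sup>2 + e * (x \<bullet> (x - y)) = 0"
    by (simp add: power2_norm_eq_inner algebra_simps)
  then have "e * (x \<bullet> (x - y)) \<le> 0" using zero_le_power2[of "norm (a - f)"] by linarith
  then have le: "x \<bullet> x \<le> x \<bullet> y" using e by (simp add: mult_le_0_iff inner_diff_right)
  have "norm x * norm x \<le> norm x * norm y"
    using le norm_cauchy_schwarz[of x y] by (simp add: power2_eq_square flip: power2_norm_eq_inner)
  then show nxy: "norm x \<le> norm y" by (cases "x = 0") auto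
  show "(norm (x - y))\<^sup>2 \<le> (y - x) \<bullet> y"
    using le by (simp add: power2_norm_eq_inner inner_diff_left inner_diff_right inner_commute)
  have "x \<bullet> y \<le> norm y * norm y"
    using norm_cauchy_schwarz[of x y] mult_right_mono[OF nxy, of "norm y"] by simp
  then have "e * (x \<bullet> (y - x)) \<le> e * (norm y)\<^sup>2"
    using e inner_ge_zero[of x]
    by (intro mult_left_mono) (simp_all add: inner_diff_right power2_eq_square del: inner_ge_zero)
  with eq have "(norm (a - f))\<^sup>2 \<le> e * (norm y)\<^sup>2" by (simp add: inner_diff_right algebra_simps)
  with a(1) show "\<exists>a. (x, a) \<in> A \<and> (norm (a - f))\<^sup>2 \<le> e * (norm y)\<^sup>2" by blast
qed

text \<open>
  Since \<open>y\<close> is a limit of vectors \<open>A\<^sup>* v\<close> and \<open>\<langle>y - x, A\<^sup>* v\<rangle> = \<langle>f - A x, v\<rangle> = O(\<surd>e)\<close>, the bound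
  \<open>\<parallel>x - y\<parallel>\<^sup>2 \<le> \<langle>y - x, y\<rangle>\<close> turns this weak convergence into norm convergence.
\<close>

lemma tikhonov_tendsto:
  assumes y: "(y, f) \<in> A" and orth: "\<And>q. q \<in> null_space A \<Longrightarrow> y \<bullet> q = 0"
    and X: "\<And>e. 0 < e \<Longrightarrow> (f, X e) \<in> tikhonov A e"
  shows "(X \<longlongrightarrow> y) (at_right 0)"
proof (rule tendstoI)
  fix r :: real assume r: "0 < r"
  \<comment> \<open>Since \<open>norm (y - X e) \<le> 2 * norm y\<close>, this makes the error from
    replacing \<open>y\<close> by \<open>w\<close> at most \<open>r^2 / 2\<close>; the 1 covers
    \<open>y = 0\<close>.\<close>
  define \<delta> where "\<delta> = r\<^sup>2 / (4 * (norm y + 1))"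
  have \<delta>: "0 < \<delta>" using r by (simp add: \<delta>_def add_nonneg_pos)
  obtain v w where vw: "(v, w) \<in> adjoint_op inner A" "norm (y - w) < \<delta>"
    using in_closure_Range_adjoint[OF orth] \<delta>
    unfolding closure_approachable by (auto simp: dist_norm norm_minus_commute)
  have main: "(norm (X e - y))\<^sup>2 \<le> norm v * (sqrt e * norm y) + r\<^sup>2 / 2" if e: "0 < e" for e
  proof -
    note ed = tikhonov_exact_data[OF y X[OF e] e]
    obtain a where a: "(X e, a) \<in> A" "(norm (a - f))\<^sup>2 \<le> e * (norm y)\<^sup>2" using ed(3) by blast
    have "(y - X e, f - a) \<in> A" using subspace_diff[OF subspace y a(1)] by simp
    then have "(y - X e) \<bullet> w = (f - a) \<bullet> v" using vw(1) by (fastforce simp: adjoint_op_inner_iff)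
    also have "\<dots> \<le> norm (f - a) * norm v" by (rule norm_cauchy_schwarz)
    also have "norm (f - a) \<le> sqrt (e * (norm y)\<^sup>2)"
      using a(2) by (simp add: real_le_rsqrt norm_minus_commute)
    finally have 1: "(y - X e) \<bullet> w \<le> norm v * (sqrt e * norm y)"
      by (simp add: real_sqrt_mult mult_right_mono mult.commute)
    have "(y - X e) \<bullet> (y - w) \<le> norm (y - X e) * norm (y - w)" by (rule norm_cauchy_schwarz)
    also have "\<dots> \<le> (2 * (norm y + 1)) * \<delta>"
      using ed(1) norm_triangle_ineq4[of y "X e"] vw(2) by (intro mult_mono) auto
    also have "\<dots> = r\<^sup>2 / 2" by (simp add: \<delta>_def field_simps add_nonneg_eq_0_iff)
    finally have "(y - X e) \<bullet> y \<le> norm v * (sqrt e * norm y) + r\<^sup>2 / 2"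
      using 1 by (simp add: inner_diff_right)
    with ed(2) show ?thesis by linarith
  qed
  have "((\<lambda>e. norm v * (sqrt e * norm y) + r\<^sup>2 / 2) \<longlongrightarrow> norm v * (sqrt 0 * norm y) + r\<^sup>2 / 2) (at_right 0)"
    by (intro tendsto_intros)
  then have "eventually (\<lambda>e. norm v * (sqrt e * norm y) + r\<^sup>2 / 2 < r\<^sup>2) (at_right 0)"
    using r by (auto dest!: order_tendstoD(2)[where a = "r\<^sup>2"])
  moreover have "eventually (\<lambda>e::real. 0 < e) (at_right 0)" by (rule eventually_at_right_less)
  ultimately show "eventually (\<lambda>e. dist (X e) y < r) (at_right 0)"
  proof eventually_elim
    case (elim e)
    then have "(norm (X e - y))\<^sup>2 < r\<^sup>2" using main[of e] by linarith
    then show ?case using r by (simp add: dist_norm power2_less_imp_less)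
  qed
qed

text \<open>Subtracting the two equations tested with \<open>x - x'\<close> leaves
  \<open>(e' - e) * (x' \<bullet> (x - x'))\<close> on the right, and
  \<open>norm x' \<le> norm y\<close> bounds it uniformly in \<open>e'\<close>.\<close>

lemma tikhonov_lipschitz:
  assumes y: "(y, f) \<in> A" and e: "0 < e" "0 < e'"
    and x: "(f, x) \<in> tikhonov A e" "(f, x') \<in> tikhonov A e'"
  shows "e * norm (x - x') \<le> \<bar>e - e'\<bar> * norm y"
proof -
  from x obtain a a' where a: "(x, a) \<in> A" "\<And>z b. (z, b) \<in> A \<Longrightarrow> a \<bullet> b + e * (x \<bullet> z) = f \<bullet> b"
    and a': "(x', a') \<in> A" "\<And>z b. (z, b) \<in> A \<Longrightarrow> a' \<bullet> b + e' * (x' \<bullet> z) = f \<bullet> b"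
    by (elim tikhonovE) blast
  have d: "(x - x', a - a') \<in> A" using subspace_diff[OF subspace a(1) a'(1)] by simp
  have "(a - a') \<bullet> (a - a') + e * ((x - x') \<bullet> (x - x')) = (e' - e) * (x' \<bullet> (x - x'))"
    using a(2)[OF d] a'(2)[OF d] by (simp add: inner_diff_left algebra_simps)
  then have "e * (norm (x - x'))\<^sup>2 \<le> (e' - e) * (x' \<bullet> (x - x'))"
    using inner_ge_zero[of "a - a'"] unfolding power2_norm_eq_inner by linarith
  also have "\<dots> \<le> \<bar>e' - e\<bar> * \<bar>x' \<bullet> (x - x')\<bar>" by (metis abs_ge_self abs_mult)
  also have "\<dots> \<le> \<bar>e' - e\<bar> * (norm y * norm (x - x'))"
    using Cauchy_Schwarz_ineq2[of x' "x - x'"] tikhonov_exact_data(1)[OF y x(2) e(2)]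
    by (intro mult_left_mono order_trans[OF Cauchy_Schwarz_ineq2] mult_right_mono) auto
  finally have "(e * norm (x - x')) * norm (x - x') \<le> (\<bar>e - e'\<bar> * norm y) * norm (x - x')"
    by (simp add: power2_eq_square mult_ac abs_minus_commute)
  then show ?thesis by (cases "x = x'") auto
qed

lemma tikhonov_continuous_on:
  assumes y: "(y, f) \<in> A" and X: "\<And>e. 0 < e \<Longrightarrow> (f, X e) \<in> tikhonov A e"
  shows "continuous_on {0<..} X"
  unfolding continuous_on_def
proof
  fix e :: real assume "e \<in> {0<..}"
  then have e: "0 < e" by simp
  have "((\<lambda>e'. \<bar>e - e'\<bar> * norm y / e) \<longlongrightarrow> \<bar>e - e\<bar> * norm y / e) (at e within {0<..})"
    using e by (intro tendsto_intros) auto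
  then have lim: "((\<lambda>e'. \<bar>e - e'\<bar> * norm y / e) \<longlongrightarrow> 0) (at e within {0<..})" by simp
  have ev: "eventually (\<lambda>e'. norm (X e' - X e) \<le> \<bar>e - e'\<bar> * norm y / e) (at e within {0<..})"
  proof -
    have "norm (X e' - X e) \<le> \<bar>e - e'\<bar> * norm y / e" if "0 < e'" for e'
      using tikhonov_lipschitz[OF y e that X[OF e] X[OF that]] e
      by (simp add: field_simps norm_minus_commute)
    then show ?thesis by (auto simp: eventually_at_filter)
  qed
  have "((\<lambda>e'. X e' - X e) \<longlongrightarrow> 0) (at e within {0<..})"
    by (rule Lim_null_comparison[OF ev lim])
  then show "(X \<longlongrightarrow> X e) (at e within {0<..})" by (simp add: LIM_zero_iff)
qed

end

section \<open>Reduction to the real inner product\<close>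

text \<open>For \<open>r\<close> nonzero, cancel \<open>r\<close> in the axiom on
  \<open>conjugate a * a\<close>; for 0, use additivity.\<close>

lemma conjugate_of_nonneg_real:
  assumes "0 \<le> r"
  shows "conjugate (of_real r :: 'k::hilbert_scalar) = of_real r"
proof (cases "r = 0")
  case True
  have "conjugate (0 + 0 :: 'k) = conjugate 0 + conjugate 0" by (rule conjugate_add)
  with True show ?thesis by simp
next
  case False
  have "conjugate (of_real r :: 'k) * of_real r = of_real r * of_real r"
    using conjugate_mult_self[of "of_real r :: 'k"] assms
    by (simp add: power2_eq_square scaleR_conv_of_real)
  with False show ?thesis by simp
qed

context hilbert_space
begin

lemma ip_add_right: "ip z (x + y) = ip z x + ip z y"
  by (metis ip_commute ip_add_left conjugate_add)

text \<open>Polarisation: expand \<open>ip_self\<close> at \<open>x + y\<close>. It identifies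
  \<open>inner\<close> with the real part of \<open>ip\<close> for either kind of scalar.\<close>

lemma ip_plus_conjugate: "ip x y + conjugate (ip x y) = of_real (2 * (x \<bullet> y))"
proof -
  have "ip (x + y) (x + y) = ip x x + ip y y + (ip x y + ip y x)"
    by (simp add: ip_add_left ip_add_right algebra_simps)
  then have "of_real (x \<bullet> x + y \<bullet> y + 2 * (x \<bullet> y)) = of_real (x \<bullet> x + y \<bullet> y) + (ip x y + ip y x)"
    by (simp add: ip_self inner_add_left inner_add_right inner_commute algebra_simps)
  then have "ip x y + ip y x = of_real (2 * (x \<bullet> y))" by simp
  then show ?thesis by (simp flip: ip_commute)
qed

lemma inner_eq_of_ip_eq:
  assumes "ip x y = ip x' y'"
  shows "x \<bullet> y = x' \<bullet> y'"
  using ip_plus_conjugate[of x y] ip_plus_conjugate[of x' y'] assms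
  by (metis mult_cancel_left of_real_eq_iff zero_neq_numeral)

text \<open>Letting a scalar \<open>c\<close> vary recovers the whole of \<open>ip\<close> from real
  parts: the real part of \<open>c * d\<close> vanishes for every \<open>c\<close>, where
  \<open>d\<close> is the difference of the two values.\<close>

lemma ip_eq_of_inner_eq:
  assumes "\<And>c. scl c x \<bullet> y = scl c x' \<bullet> y'"
  shows "ip x y = ip x' y'"
proof -
  have *: "c * ip x y + conjugate (c * ip x y) = c * ip x' y' + conjugate (c * ip x' y')" for c
    using ip_plus_conjugate[of "scl c x" y] ip_plus_conjugate[of "scl c x'" y'] assms[of c]
    by (simp add: ip_scale_left)
  define d where "d = ip x y - ip x' y'"
  have "c * d + conjugate (c * d) = 0" for c
  proof -
    have "conjugate (c * ip x y) = conjugate (c * d) + conjugate (c * ip x' y')"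
      by (simp add: d_def algebra_simps flip: conjugate_add)
    with *[of c] show ?thesis by (simp add: d_def algebra_simps)
  qed
  \<comment> \<open>With this \<open>c\<close> the product is \<open>norm d\<close> squared, a
    nonnegative real fixed by conjugation, so twice it is 0.\<close>
  note cd = this[of "conjugate d"]
  have dd: "conjugate d * d = of_real ((norm d)\<^sup>2)"
    by (simp only: conjugate_mult_self scaleR_conv_of_real mult_1_right)
  have "of_real ((norm d)\<^sup>2 + (norm d)\<^sup>2) = 0 * d"
    using cd unfolding dd conjugate_of_nonneg_real[OF zero_le_power2] by (simp only: of_real_add mult_zero_left)
  then have "(norm d)\<^sup>2 + (norm d)\<^sup>2 = 0" by (simp only: mult_zero_left of_real_eq_0_iff)
  then have "d = 0" by simp
  then show ?thesis by (simp add: d_def)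
qed

text \<open>The graph is stable under every scalar \<open>c\<close>, so the real identity is
  available for all pairs \<open>(scl c x, scl c y)\<close>, which determines
  \<open>ip\<close>.\<close>

lemma adjoint_op_eq_inner:
  assumes A: "linear_operator scl A"
  shows "adjoint_op ip A = adjoint_op inner A"
proof (intro equalityI subrelI)
  fix v w assume "(v, w) \<in> adjoint_op ip A"
  then show "(v, w) \<in> adjoint_op inner A"
    by (auto simp: adjoint_op_def intro: inner_eq_of_ip_eq)
next
  fix v w assume vw: "(v, w) \<in> adjoint_op inner A"
  have "ip y v = ip x w" if xy: "(x, y) \<in> A" for x y
  proof (rule ip_eq_of_inner_eq)
    fix c
    have "(scl c x, scl c y) \<in> A" using A xy by (auto simp: linear_operator_def)
    then show "scl c y \<bullet> v = scl c x \<bullet> w" using vw by (auto simp: adjoint_op_def)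
  qed
  then show "(v, w) \<in> adjoint_op ip A" by (auto simp: adjoint_op_def)
qed

lemma S_op_eq_inner:
  assumes "linear_operator scl A"
  shows "S_op ip A e = S_op inner A e"
  by (simp add: S_op_def T_op_def adjoint_op_eq_inner[OF assms])

lemma subspace_linear_operator:
  assumes A: "linear_operator scl A"
  shows "Real_Vector_Spaces.subspace A"
proof -
  have "(r *\<^sub>R x, r *\<^sub>R y) \<in> A" if "(x, y) \<in> A" for r x y
  proof -
    have "(scl (of_real r) x, scl (of_real r) y) \<in> A"
      using A that by (auto simp: linear_operator_def)
    then show ?thesis by (simp add: scale_of_real)
  qed
  moreover have "(x + x', y + y') \<in> A" if "(x, y) \<in> A" "(x', y') \<in> A" for x y x' y'
    using A that unfolding linear_operator_def by blast
  moreover have "(0, 0) \<in> A" using A by (simp add: linear_operator_def)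
  ultimately show ?thesis
    unfolding Real_Vector_Spaces.subspace_def by (auto simp: zero_prod_def)
qed

end

theorem theorem5:
  fixes scl :: "'k::hilbert_scalar \<Rightarrow> 'h::{real_inner, complete_space} \<Rightarrow> 'h"
    and ip :: "'h \<Rightarrow> 'h \<Rightarrow> 'k"
    and A :: "('h \<times> 'h) set"
    and f y u0 :: 'h
    and eps :: "real \<Rightarrow> real"
  assumes "hilbert_space scl ip"
    and "linear_operator scl A"
    and "closed A"
    and "closure (Domain A) = UNIV"
    and "y \<in> Domain A" and "f = op_apply A y"
    and "\<forall>x \<in> null_space A. ip y x = 0"
    and "continuous_on {0..} eps"
    and "\<forall>t\<ge>0. eps t > 0"
    and "antimono_on {0..} eps"
    and "(eps \<longlongrightarrow> 0) at_top"
    and "(\<integral>\<^sup>+ s \<in> {0..}. ennreal (eps s) \<partial>lborel) = \<infinity>"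
  shows "\<exists>u. cauchy_solution (\<lambda>t x. - x + op_apply (S_op ip A (eps t)) f) u0 u
           \<and> (\<forall>v. cauchy_solution (\<lambda>t x. - x + op_apply (S_op ip A (eps t)) f) u0 v
                  \<longrightarrow> (\<forall>t\<ge>0. v t = u t))
           \<and> (u \<longlongrightarrow> y) at_top"
proof -
  interpret hilbert_space scl ip by fact
  have sv: "single_valued A" using assms(2) by (simp add: linear_operator_def)
  interpret closed_graph_operator A
    using subspace_linear_operator[OF assms(2)] assms(3) sv by unfold_locales
  have yf: "(y, f) \<in> A"
  proof -
    obtain f' where f': "(y, f') \<in> A" using assms(5) by blast
    then have "op_apply A y = f'"
      unfolding op_apply_def using sv by (blast intro: the_equality dest: single_valuedD)
    with f' assms(6) show ?thesis by simp
  qed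
  have orth: "y \<bullet> q = 0" if "q \<in> null_space A" for q
  proof -
    \<comment> \<open>The value 0 is written as an \<open>ip\<close> value so that equality of
      \<open>ip\<close> values can be transferred to \<open>inner\<close>.\<close>
    have "ip y q = ip (scl 0 y) q" using assms(7) that by (simp only: ip_scale_left) simp
    then show ?thesis using inner_eq_of_ip_eq by fastforce
  qed
  define X where "X e = op_apply (S_op ip A e) f" for e
  have X: "(f, X e) \<in> tikhonov A e" if "0 < e" for e
    unfolding X_def S_op_eq_inner[OF assms(2)] by (rule op_apply_S_op[OF that])
  have "continuous_on {0..} (\<lambda>t. X (eps t))"
    using assms(9) by (intro continuous_on_compose2[OF tikhonov_continuous_on[OF yf X] assms(8)]) auto
  from relaxation_solution_exists[OF this] obtain u
    where u: "cauchy_solution (\<lambda>t x. - x + X (eps t)) u0 u" by blast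
  have "eventually (\<lambda>t. 0 < eps t) at_top"
    using eventually_ge_at_top[of 0] by eventually_elim (use assms(9) in auto)
  \<comment> \<open>Positivity makes \<open>eps\<close> approach 0 from the right, so the limit of
    \<open>X\<close> in the parameter composes with it into a limit in time.\<close>
  then have eps: "filterlim eps (at_right 0) at_top"
    using assms(11) by (auto simp: filterlim_at elim: eventually_mono)
  have "(X \<longlongrightarrow> y) (at_right 0)"
    using yf orth X by (rule tikhonov_tendsto)
  from this eps have "((\<lambda>t. X (eps t)) \<longlongrightarrow> y) at_top"
    by (rule filterlim_compose)
  then have "(u \<longlongrightarrow> y) at_top" by (rule relaxation_solution_tendsto[OF u])
  with u relaxation_solution_unique[OF u] show ?thesis
    unfolding X_def by blast
qed

end
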